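(* Let $A\in O_2(\mathbb{R})$. Then the set of determinants of lattices in $\mathrm{WR}(A\mathbb{Z}^2)$ is equal to $\mathcal{D}$, and the set of squared minima $|\Lambda|^2$ of lattices $\Lambda\in\mathrm{WR}(A\mathbb{Z}^2)$ is equal to $\mathfrak{M}$. Moreover, for each $u\in\mathcal{D}$ the number of lattices in $\mathrm{WR}(A\mathbb{Z}^2)$ with determinant equal to $u$ is $\mathcal{N}(u)$.
   Context: A full-rank lattice $\Lambda\subset\mathbb{R}^2$ has minimum $|\Lambda|=\min_{0\ne x\in\Lambda}\|x\|$ (Euclidean norm) and set of minimal vectors $S(\Lambda)=\{x\in\Lambda:\|x\|=|\Lambda|\}$; it is well-rounded (WR) if $S(\Lambda)$ spans $\mathbb{R}^2$. For a full-rank lattice $\Omega\subset\mathbb{R}^2$, $\mathrm{WR}(\Omega)$ is the set of all full-rank well-rounded sublattices of $\Omega$. $O_2(\mathbb{R})$ is the real orthogonal group. Put $\mathcal{D}=\{\det(\Lambda):\Lambda\in\mathrm{WR}(\mathbb{Z}^2)\}$ and $\mathfrak{M}=\{|\Lambda|^2:\Lambda\in\mathrm{WR}(\mathbb{Z}^2)\}$, where $\det(\Lambda)>0$ is the covolume. For a positive integer $u$, $\mathcal{N}(u)$ is the number of lattices in $\mathrm{WR}(\mathbb{Z}^2)$ with determinant $u$. *)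

theory Defs
  imports "HOL-Analysis.Analysis"
begin

definition int_lattice :: "(real^2) set" where
  "int_lattice = {x. \<forall>i. x $ i \<in> \<int>}"

text \<open>The columns of the matrix \<open>B\<close> are a lattice basis.\<close>

definition full_rank_lattice :: "(real^2) set \<Rightarrow> bool" where
  "full_rank_lattice L \<longleftrightarrow>
     (\<exists>B :: real^2^2. invertible B \<and> L = (\<lambda>x. B *v x) ` int_lattice)"

text \<open>The covolume; it does not depend on the basis, see \<open>lattice_det_eq\<close> below.\<close>

definition lattice_det :: "(real^2) set \<Rightarrow> real" where
  "lattice_det L =
     (THE d. \<exists>B :: real^2^2. invertible B \<and> L = (\<lambda>x. B *v x) ` int_lattice \<and> d = \<bar>det B\<bar>)"

text \<open>For a lattice the minimum is attained, so the least norm exists.\<close>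

definition lattice_min :: "(real^2) set \<Rightarrow> real" where
  "lattice_min L = (LEAST r. \<exists>x\<in>L. x \<noteq> 0 \<and> r = norm x)"

definition minimal_vectors :: "(real^2) set \<Rightarrow> (real^2) set" where
  "minimal_vectors L = {x \<in> L. norm x = lattice_min L}"

definition well_rounded :: "(real^2) set \<Rightarrow> bool" where
  "well_rounded L \<longleftrightarrow> span (minimal_vectors L) = UNIV"

definition WR :: "(real^2) set \<Rightarrow> (real^2) set set" where
  "WR \<Omega> = {L. full_rank_lattice L \<and> L \<subseteq> \<Omega> \<and> well_rounded L}"

definition WR_dets :: "real set" where
  "WR_dets = lattice_det ` WR int_lattice"

definition WR_sq_minima :: "real set" where
  "WR_sq_minima = (\<lambda>L. (lattice_min L)\<^sup>2) ` WR int_lattice"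

text \<open>
  Every element of \<open>WR_dets\<close> is a positive integer; the argument is real only to match the
  type of \<open>lattice_det\<close>. The set counted is finite, see \<open>finite_WR_int_lattice_det\<close> below.
\<close>

definition WR_count :: "real \<Rightarrow> nat" where
  "WR_count u = card {L \<in> WR int_lattice. lattice_det L = u}"

lemma mult_axis_column: "(B :: real^2^2) *v axis j 1 = column j B"
  by (simp add: matrix_vector_mult_basis)

lemma axis_int_lattice: "axis j 1 \<in> int_lattice"
  by (auto simp: int_lattice_def axis_def)

lemma det_Ints:
  assumes "\<And>i j. (M :: real^2^2) $ i $ j \<in> \<int>"
  shows "det M \<in> \<int>"
  using assms by (auto simp: det_2 intro!: Ints_diff Ints_mult)

lemma abs_det_le:
  fixes B C :: "real^2^2"
  assumes "invertible B" and sub: "(\<lambda>x. B *v x) ` int_lattice \<subseteq> (\<lambda>x. C *v x) ` int_lattice"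
  shows "\<bar>det C\<bar> \<le> \<bar>det B\<bar>"
proof -
  have "\<forall>j. \<exists>z\<in>int_lattice. column j B = C *v z"
    using sub axis_int_lattice mult_axis_column by (metis image_iff subsetD imageI)
  then obtain z where z: "\<And>j. z j \<in> int_lattice" "\<And>j. column j B = C *v z j"
    by metis
  define M :: "real^2^2" where "M = (\<chi> i j. z j $ i)"
  have "B = C ** M"
    using z(2) by (simp add: vec_eq_iff M_def column_def matrix_matrix_mult_def
        matrix_vector_mult_def)
  then have d: "det B = det C * det M" by (simp add: det_mul)
  have "det M \<in> \<int>" using z(1) by (intro det_Ints) (auto simp: M_def int_lattice_def)
  moreover have "det M \<noteq> 0" using assms(1) d invertible_det_nz[of B] by (metis mult_zero_right)
  ultimately have "\<bar>det M\<bar> \<ge> 1" by (rule Ints_nonzero_abs_ge1)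
  then have "\<bar>det C\<bar> * 1 \<le> \<bar>det C\<bar> * \<bar>det M\<bar>" by (intro mult_left_mono) auto
  then show ?thesis by (simp add: d abs_mult)
qed

lemma lattice_det_eq:
  fixes B :: "real^2^2"
  assumes "invertible B"
  shows "lattice_det ((\<lambda>x. B *v x) ` int_lattice) = \<bar>det B\<bar>"
  unfolding lattice_det_def
proof (rule the_equality)
  show "\<exists>C :: real^2^2. invertible C \<and>
      (\<lambda>x. B *v x) ` int_lattice = (\<lambda>x. C *v x) ` int_lattice \<and> \<bar>det B\<bar> = \<bar>det C\<bar>"
    using assms by blast
next
  fix d
  assume "\<exists>C :: real^2^2. invertible C \<and>
      (\<lambda>x. B *v x) ` int_lattice = (\<lambda>x. C *v x) ` int_lattice \<and> d = \<bar>det C\<bar>"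
  then show "d = \<bar>det B\<bar>"
  proof (elim exE conjE)
    fix C :: "real^2^2"
    assume C: "invertible C" "(\<lambda>x. B *v x) ` int_lattice = (\<lambda>x. C *v x) ` int_lattice" "d = \<bar>det C\<bar>"
    show "d = \<bar>det B\<bar>"
      using abs_det_le[OF assms, of C] abs_det_le[OF C(1), of B] C(2,3) by simp
  qed
qed

lemma lattice_add:
  assumes "full_rank_lattice L" "x \<in> L" "y \<in> L"
  shows "x + y \<in> L"
proof -
  obtain B :: "real^2^2" where L: "L = (\<lambda>x. B *v x) ` int_lattice"
    using assms(1) by (auto simp: full_rank_lattice_def)
  obtain a b where "a \<in> int_lattice" "b \<in> int_lattice" "x = B *v a" "y = B *v b"
    using assms L by auto
  then show ?thesis
    unfolding L by (intro image_eqI[of _ _ "a + b"])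
      (auto simp: int_lattice_def matrix_vector_right_distrib)
qed

lemma det_scale_mem:
  assumes L: "full_rank_lattice L" "L \<subseteq> int_lattice" and z: "z \<in> int_lattice"
  shows "lattice_det L \<in> \<int>" "lattice_det L > 0" "lattice_det L *\<^sub>R z \<in> L"
proof -
  obtain B :: "real^2^2" where B: "invertible B" "L = (\<lambda>x. B *v x) ` int_lattice"
    using L by (auto simp: full_rank_lattice_def)
  have ld: "lattice_det L = \<bar>det B\<bar>" using lattice_det_eq B by simp
  have Bint: "B $ i $ j \<in> \<int>" for i j
  proof -
    have "B *v axis j 1 \<in> int_lattice" using B(2) L(2) axis_int_lattice by auto
    then show ?thesis by (simp add: mult_axis_column int_lattice_def column_def)
  qed
  have "det B \<in> \<int>" using Bint by (rule det_Ints)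
  then show "lattice_det L \<in> \<int>" by (simp add: ld)
  show "lattice_det L > 0" using B(1) by (simp add: ld invertible_det_nz)
  define w :: "real^2" where
    "w = sgn (det B) *\<^sub>R vector [B$2$2 * z$1 - B$1$2 * z$2, B$1$1 * z$2 - B$2$1 * z$1]"
  have s: "sgn (det B) \<in> \<int>" by (auto simp: sgn_if)
  have "w \<in> int_lattice"
    using z Bint s by (auto simp: int_lattice_def w_def forall_2 vector_2
        intro!: Ints_mult Ints_diff)
  moreover have "B *v w = lattice_det L *\<^sub>R z"
    by (simp add: vec_eq_iff forall_2 matrix_vector_mult_def sum_2 w_def vector_2 ld
        abs_sgn det_2 algebra_simps)
  ultimately show "lattice_det L *\<^sub>R z \<in> L" using B(2) by (metis imageI)
qed

lemma finite_sublattices_det: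
  "finite {L. full_rank_lattice L \<and> L \<subseteq> int_lattice \<and> lattice_det L = u}" (is "finite ?S")
proof (cases "u \<in> \<int> \<and> u > 0")
  case False
  then have "?S = {}" using det_scale_mem(1,2)[of _ 0] by (auto simp: int_lattice_def)
  then show ?thesis by (simp only: finite.emptyI)
next
  case True
  define box :: "(real^2) set" where "box = {x \<in> int_lattice. \<forall>i. 0 \<le> x $ i \<and> x $ i < u}"
  have "finite {k. 0 \<le> real_of_int k \<and> real_of_int k < u}"
    by (rule finite_subset[of _ "{0..\<lceil>u\<rceil>}"]) (auto, linarith)
  then have fin: "finite (real_of_int ` {k. 0 \<le> real_of_int k \<and> real_of_int k < u})" (is "finite ?K")
    by simp
  have "box \<subseteq> (\<lambda>(a, b). vector [a, b]) ` (?K \<times> ?K)"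
  proof
    fix x assume x: "x \<in> box"
    have "x $ i \<in> ?K" for i
    proof -
      obtain k where "x $ i = of_int k"
        using x by (auto simp: box_def int_lattice_def Ints_def)
      moreover have "0 \<le> x $ i" "x $ i < u" using x by (auto simp: box_def)
      ultimately show ?thesis by (intro image_eqI[of _ _ k]) auto
    qed
    moreover have "x = vector [x $ 1, x $ 2]"
      by (simp add: vec_eq_iff forall_2 vector_2)
    ultimately show "x \<in> (\<lambda>(a, b). vector [a, b]) ` (?K \<times> ?K)"
      by (intro image_eqI[of _ _ "(x $ 1, x $ 2)"]) auto
  qed
  then have finbox: "finite box" using fin by (meson finite_SigmaI finite_imageI finite_subset)
  have sub: "L \<subseteq> L'" if L: "L \<in> ?S" "L' \<in> ?S" "L \<inter> box = L' \<inter> box" for L L'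
  proof
    fix x assume x: "x \<in> L"
    then have xi: "x \<in> int_lattice" using L by auto
    define q :: "real^2" where "q = (\<chi> i. of_int \<lfloor>x $ i / u\<rfloor>)"
    have q: "q \<in> int_lattice" "- q \<in> int_lattice" by (auto simp: q_def int_lattice_def)
    define y where "y = x + u *\<^sub>R (- q)"
    have yL: "y \<in> L"
      unfolding y_def using L x q det_scale_mem(3)[of L "- q"] by (intro lattice_add) auto
    have "0 \<le> y $ i \<and> y $ i < u" for i
    proof -
      have u: "u > 0" using True by simp
      have "of_int \<lfloor>x $ i / u\<rfloor> \<le> x $ i / u" "x $ i / u < of_int \<lfloor>x $ i / u\<rfloor> + 1"
        by linarith+
      then have "of_int \<lfloor>x $ i / u\<rfloor> * u \<le> x $ i" "x $ i < (of_int \<lfloor>x $ i / u\<rfloor> + 1) * u"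
        unfolding pos_le_divide_eq[OF u] pos_divide_less_eq[OF u] .
      then show ?thesis by (simp add: y_def q_def algebra_simps)
    qed
    then have "y \<in> box" using yL L by (auto simp: box_def)
    then have "y \<in> L'" using yL L by auto
    moreover have "u *\<^sub>R q \<in> L'" using L q det_scale_mem(3)[of L' q] by auto
    ultimately have "y + u *\<^sub>R q \<in> L'" using L by (intro lattice_add) auto
    then show "x \<in> L'" by (simp add: y_def)
  qed
  have "inj_on (\<lambda>L. L \<inter> box) ?S"
    by (rule inj_onI, rule subset_antisym) (rule sub; simp)+
  moreover have "(\<lambda>L. L \<inter> box) ` ?S \<subseteq> Pow box" by auto
  ultimately show ?thesis
    using finbox by (meson finite_Pow_iff finite_subset inj_on_finite)
qed

lemma finite_WR_int_lattice_det: "finite {L \<in> WR int_lattice. lattice_det L = u}"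
  by (rule finite_subset[OF _ finite_sublattices_det[of u]]) (auto simp: WR_def)

end

theory Submission
  imports Defs
begin

text \<open>Multiplication by \<open>A\<close> is a linear isometry of the plane, so replacing a
  lattice \<open>L\<close> by its image changes nothing that is measured here: the covolume is
  multiplied by the absolute value of \<open>det A\<close>, which is 1
  (\<open>lattice_det_orthogonal_image\<close>), and the norms of the nonzero vectors stay the same
  (\<open>lattice_min_orthogonal_image\<close>). Minimal vectors go to minimal vectors, so
  well-roundedness survives. As the transpose is an orthogonal inverse, taking images is a bijection
  from the well-rounded sublattices of \<Omega> to those of its image
  (\<open>WR_orthogonal_image\<close> gives surjectivity). With the integer lattice as \<Omega>, all
  three claims follow by transport along this bijection.\<close>

lemma orthogonal_matrix_transformation:
  fixes A :: "real^'n^'n"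
  assumes "orthogonal_matrix A"
  shows "orthogonal_transformation ((*v) A)"
  using assms by (simp add: orthogonal_transformation_matrix)

lemma orthogonal_matrix_norm:
  fixes A :: "real^'n^'n"
  assumes "orthogonal_matrix A"
  shows "norm (A *v x) = norm x"
  using orthogonal_matrix_transformation[OF assms] by (rule orthogonal_transformation_norm)

lemma orthogonal_matrix_mult_eq_0:
  fixes A :: "real^'n^'n"
  assumes "orthogonal_matrix A"
  shows "A *v x = 0 \<longleftrightarrow> x = 0"
  using orthogonal_matrix_norm[OF assms, of x] by (metis norm_eq_zero)

lemma image_matrix_mul:
  fixes A :: "real^'n^'m" and B :: "real^'k^'n"
  shows "(*v) A ` (*v) B ` S = (*v) (A ** B) ` S"
  by (simp only: image_image matrix_vector_mul_assoc)

lemma orthogonal_matrix_transpose_image: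
  fixes A :: "real^'n^'n"
  assumes "orthogonal_matrix A"
  shows "(*v) A ` (*v) (transpose A) ` S = S"
  using assms unfolding image_matrix_mul by (simp add: orthogonal_matrix_def)

context
  fixes A :: "real^2^2"
  assumes orth: "orthogonal_matrix A"
begin

lemma invertible_orthogonal: "invertible A"
  using orth by (auto simp: invertible_def orthogonal_matrix_def)

lemma full_rank_lattice_orthogonal_image:
  assumes "full_rank_lattice L"
  shows "full_rank_lattice ((*v) A ` L)"
proof -
  obtain B :: "real^2^2" where B: "invertible B" "L = (*v) B ` int_lattice"
    using assms by (auto simp: full_rank_lattice_def)
  have "invertible (A ** B)"
    by (rule invertible_mult[OF invertible_orthogonal B(1)])
  moreover have "(*v) A ` L = (*v) (A ** B) ` int_lattice"
    by (simp only: B(2) image_matrix_mul)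
  ultimately show ?thesis
    unfolding full_rank_lattice_def by blast
qed

text \<open>If the columns of \<open>B\<close> form a basis of \<open>L\<close>, those of
  \<open>A ** B\<close> form a basis of the image, and the determinant is multiplicative.\<close>

lemma lattice_det_orthogonal_image:
  assumes "full_rank_lattice L"
  shows "lattice_det ((*v) A ` L) = lattice_det L"
proof -
  obtain B :: "real^2^2" where B: "invertible B" "L = (*v) B ` int_lattice"
    using assms by (auto simp: full_rank_lattice_def)
  have "\<bar>det A\<bar> = 1"
    using det_orthogonal_matrix[OF orth] by auto
  then show ?thesis
    using B invertible_mult[OF invertible_orthogonal B(1)]
    by (simp add: image_matrix_mul lattice_det_eq det_mul abs_mult)
qed

text \<open>Both \<open>LEAST\<close> terms range over the same set of norms, since \<open>A\<close>
  preserves norms and sends only 0 to 0.\<close>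

lemma lattice_min_orthogonal_image: "lattice_min ((*v) A ` L) = lattice_min L"
  by (simp add: lattice_min_def orthogonal_matrix_norm[OF orth]
      orthogonal_matrix_mult_eq_0[OF orth])

lemma minimal_vectors_orthogonal_image:
  "minimal_vectors ((*v) A ` L) = (*v) A ` minimal_vectors L"
  by (auto simp: minimal_vectors_def lattice_min_orthogonal_image orthogonal_matrix_norm[OF orth])

lemma well_rounded_orthogonal_image:
  assumes "well_rounded L"
  shows "well_rounded ((*v) A ` L)"
proof -
  \<comment> \<open>Span commutes with linear images, so the new minimal vectors span the image of
    the whole plane, which is the plane.\<close>
  have "surj ((*v) A)"
    using orthogonal_matrix_transformation[OF orth] by (rule orthogonal_transformation_surj)
  then show ?thesis
    using assms by (simp add: well_rounded_def minimal_vectors_orthogonal_image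
        linear_span_image[OF matrix_vector_mul_linear])
qed

lemma WR_orthogonal_image_mem:
  assumes "L \<in> WR \<Omega>"
  shows "(*v) A ` L \<in> WR ((*v) A ` \<Omega>)"
  using assms full_rank_lattice_orthogonal_image well_rounded_orthogonal_image
  by (auto simp: WR_def)

end

text \<open>One inclusion is \<open>WR_orthogonal_image_mem\<close> for \<open>A\<close>; the other
  is the same fact for the transpose, which undoes \<open>A\<close>.\<close>

lemma WR_orthogonal_image:
  fixes A :: "real^2^2"
  assumes "orthogonal_matrix A"
  shows "WR ((*v) A ` \<Omega>) = (`) ((*v) A) ` WR \<Omega>"
proof
  have t: "orthogonal_matrix (transpose A)"
    using assms by simp
  show "WR ((*v) A ` \<Omega>) \<subseteq> (`) ((*v) A) ` WR \<Omega>"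
  proof
    fix L assume "L \<in> WR ((*v) A ` \<Omega>)"
    then have "(*v) (transpose A) ` L \<in> WR \<Omega>"
      using WR_orthogonal_image_mem[OF t] orthogonal_matrix_transpose_image[OF t]
      by (metis transpose_transpose)
    then show "L \<in> (`) ((*v) A) ` WR \<Omega>"
      using orthogonal_matrix_transpose_image[OF assms] by (metis imageI)
  qed
qed (use WR_orthogonal_image_mem[OF assms] in auto)

theorem corollary1p4:
  fixes A :: "real^2^2"
  assumes "orthogonal_matrix A"
  shows "lattice_det ` WR ((\<lambda>x. A *v x) ` int_lattice) = WR_dets
    \<and> (\<lambda>L. (lattice_min L)\<^sup>2) ` WR ((\<lambda>x. A *v x) ` int_lattice) = WR_sq_minima
    \<and> (\<forall>u\<in>WR_dets. card {L \<in> WR ((\<lambda>x. A *v x) ` int_lattice). lattice_det L = u} = WR_count u)"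
proof (intro conjI ballI)
  note W = WR_orthogonal_image[OF assms, of int_lattice]
  \<comment> \<open>Membership in \<open>WR\<close> supplies the basis on which invariance of the
    covolume rests.\<close>
  have det: "lattice_det ((*v) A ` L) = lattice_det L" if "L \<in> WR int_lattice" for L
    using that lattice_det_orthogonal_image[OF assms] by (simp add: WR_def)
  show "lattice_det ` WR ((*v) A ` int_lattice) = WR_dets"
    by (simp add: W WR_dets_def image_image det cong: image_cong)
  show "(\<lambda>L. (lattice_min L)\<^sup>2) ` WR ((*v) A ` int_lattice) = WR_sq_minima"
    by (simp add: W WR_sq_minima_def image_image lattice_min_orthogonal_image[OF assms])
  fix u
  have "inj ((*v) A)"
    using orthogonal_matrix_transformation[OF assms] by (rule orthogonal_transformation_inj)
  \<comment> \<open>Distinct lattices have distinct images, so the count is preserved as well as the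
    set of values.\<close>
  then have "inj ((`) ((*v) A))"
    by (simp add: inj_image_eq_iff inj_def)
  moreover have "{L \<in> WR ((*v) A ` int_lattice). lattice_det L = u} =
      (`) ((*v) A) ` {L \<in> WR int_lattice. lattice_det L = u}"
    using det by (auto simp: W)
  ultimately show "card {L \<in> WR ((*v) A ` int_lattice). lattice_det L = u} = WR_count u"
    unfolding WR_count_def by (simp add: card_image[OF inj_on_subset[OF _ subset_UNIV]])
qed

end
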